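(* Let $\mathcal{H}(u)=\mathcal{G}(|u|)u$, where $\mathcal{G}(|v|)=\mathcal{L}+f(|v|)$, $\mathcal{L}$ is a self-adjoint linear differential operator and $f$ is a real-valued scalar function. Let $u$ solve $\mathrm{i}\,\partial_tu=\mathcal{L}u+f(|u|)u$ on $[t_n,t_{n+1}]$, $h=t_{n+1}-t_n$, and consider the iteration $$\mathrm{i}\,\partial_tu^{[k+1]}(t)=\mathcal{L}u^{[k+1]}(t)+f(|u^{[k]}(t)|)\,u^{[k+1]}(t),\qquad u^{[k+1]}(t_n)=u(t_n),$$ with $u^{[0]}(t)\equiv u(t_n)$, in which the first iterate $u^{[1]}$ is computed by the Strang splitting (as specified in the context) and the subsequent iterates $u^{[2]},u^{[3]},\dots$ are exact solutions of the linear equations. Set $\rho_k(t)=\|u^{[k]}(\cdot,t)-u(\cdot,t)\|_{L_2(\mathbb{T}^d)}$. Then the iterate $u^{[k]}$ has order $p_k=k+1$ for all $k\in\mathbb{N}=\{1,2,\dots\}$: there is $c_1>0$ such that $$\rho_k(t)\le\bigl[\mathcal{G}'(u)\,\|u\|_{L_2}\bigr]^{k-1}c_1\,h^{k+2},\qquad k\in\mathbb{N},\ t\in[t_n,t_{n+1}].$$ Moreover, the iteration converges, $\rho_k(t)\to0$ as $k\to\infty$, provided that $h<\bigl[\mathcal{G}'(u)\,\|u\|_{L_2}\bigr]^{-1}$.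
   Context: The spatial domain is the torus $\mathbb{T}^d$, with $u(0)=u_0\in H^s(\mathbb{T}^d)$; the $L_2$ norm $\|u\|_{L_2}=\|u(\cdot,t)\|_{L_2}$ is constant in time. Solutions and iterates are assumed to exist on the step and to be as regular as required. Write $\mathcal{G}(v)$ for $\mathcal{G}(|v|)=\mathcal{L}+f(|v|)$. Order: iterate $k$ has order $p_k$ if $\rho_k(t)\le c_kh^{p_k+1}$ on $[t_n,t_{n+1}]$ for some $c_k>0$. Fréchet differentiability: $\mathcal{G}$ is assumed Fréchet differentiable in the sense that there is a number $\mathcal{G}'(v)\in(0,\infty)$ with $\|\mathcal{G}(v+\delta)-\mathcal{G}(v)\|_{L_2}\le\mathcal{G}'(v)\|\delta\|_{L_2}$ for $v,\delta\in H^2(\mathbb{T}^d)$, $\|\delta\|_{L_2}\ll1$ (operator norm $L_2\to L_2$ on the left). $\mathcal{G}'(u)$ denotes such a number valid for $v=u(t)$ for all $t\in[t_n,t_{n+1}]$, and the errors $\delta=u^{[k]}(t)-u(t)$, $k\ge1$, are assumed to lie in the range in which the inequality holds. Strang splitting for the nonlinear equation with step $\sigma\in[0,h]$ from $t_n$: (i) solve $\mathrm{i}\,\partial_tv_1=\mathcal{L}v_1$ over a time $\sigma/2$ starting from $u(t_n)$, with end value $w$; (ii) solve $\mathrm{i}\,\partial_tv_2=f(|v_2|)v_2$ over a time $\sigma$ starting from $w$; (iii) solve $\mathrm{i}\,\partial_tv_3=\mathcal{L}v_3$ over a time $\sigma/2$ starting from the end value of (ii). The end value of (iii) is the approximation to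 $u(t_n+\sigma)$. The regularity of the problem is assumed to be such that this splitting is, as usual, a second-order method, i.e. its $L_2$ error after a single step of length $\sigma\le h$ is at most $c_1h^3$. Strang splitting for the first iterate: $u^{[1]}(t_n+\sigma)$, $\sigma\in[0,h]$, is obtained by the same three steps, except that step (ii) is replaced by the linear equation $\mathrm{i}\,\partial_tv_2=f(|w|)v_2$ over a time $\sigma$ starting from $w$, where the coefficient $f(|w|)$ is frozen at the initial value $w$ of this sub-step. *)

theory Defs
  imports "HOL-Analysis.Analysis"
begin

section \<open>Functions on the torus and the space \<open>L\<^sub>2\<close>\<close>

text \<open>
  The torus is \<open>\<real>\<^sup>d / (2 \<pi> \<int>)\<^sup>d\<close> with \<open>d = CARD('d)\<close>.  A function on it is a \<open>2 \<pi>\<close>-periodic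
  function on \<open>real ^ 'd\<close>, integrated over one period cell.
\<close>

type_synonym 'd field = "real ^ 'd \<Rightarrow> complex"

definition torus :: "(real ^ 'd::finite) measure" where
  "torus = lebesgue_on (cbox 0 (\<chi> i. 2 * pi))"

definition periodic :: "'d::finite field \<Rightarrow> bool" where
  "periodic v \<longleftrightarrow> (\<forall>x i. v (x + axis i (2 * pi)) = v x)"

text \<open>Elements of \<open>L\<^sub>2\<close> are represented by functions; equality of elements is \<open>L2_eq\<close>.\<close>

definition L2_fun :: "'d::finite field set" where
  "L2_fun = {v. periodic v \<and> v \<in> borel_measurable torus \<and> integrable torus (\<lambda>x. (cmod (v x))\<^sup>2)}"

definition L2_eq :: "'d::finite field \<Rightarrow> 'd field \<Rightarrow> bool" where
  "L2_eq v w \<longleftrightarrow> (AE x in torus. v x = w x)"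

definition L2_inner :: "'d::finite field \<Rightarrow> 'd field \<Rightarrow> complex" where
  "L2_inner v w = (LINT x|torus. v x * cnj (w x))"

definition L2_norm :: "'d::finite field \<Rightarrow> real" where
  "L2_norm v = sqrt (LINT x|torus. (cmod (v x))\<^sup>2)"

text \<open>The value is infinite if the operator leaves \<open>L\<^sub>2\<close> or is unbounded on its domain \<open>D\<close>.\<close>

definition L2_op_norm :: "'d::finite field set \<Rightarrow> ('d field \<Rightarrow> 'd field) \<Rightarrow> ennreal" where
  "L2_op_norm D A =
     (SUP z \<in> {z \<in> D. L2_norm z \<le> 1}. if A z \<in> L2_fun then ennreal (L2_norm (A z)) else top)"

section \<open>Sobolev spaces\<close>

definition fourier_coeff :: "'d::finite field \<Rightarrow> int ^ 'd \<Rightarrow> complex" where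
  "fourier_coeff v k =
     (LINT x|torus. v x * exp (- \<i> * of_real (\<Sum>i\<in>UNIV. of_int (k $ i) * x $ i)))
       / of_real ((2 * pi) ^ CARD('d))"

definition Sobolev :: "real \<Rightarrow> 'd::finite field set" where
  "Sobolev s = {v \<in> L2_fun.
     (\<lambda>k. (1 + (\<Sum>i\<in>UNIV. (of_int (k $ i))\<^sup>2)) powr s * (cmod (fourier_coeff v k))\<^sup>2)
       summable_on UNIV}"

section \<open>Self-adjoint differential operators\<close>

text \<open>An unbounded linear operator in \<open>L\<^sub>2\<close> is given by its domain \<open>D\<close> and its action \<open>L\<close> on \<open>D\<close>.\<close>

definition L2_operator :: "'d::finite field set \<Rightarrow> ('d field \<Rightarrow> 'd field) \<Rightarrow> bool" where
  "L2_operator D L \<longleftrightarrow>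
     D \<subseteq> L2_fun \<and> (\<lambda>_. 0) \<in> D \<and> (\<forall>v\<in>D. L v \<in> L2_fun) \<and>
     (\<forall>v\<in>D. \<forall>w\<in>L2_fun. L2_eq v w \<longrightarrow> w \<in> D \<and> L2_eq (L v) (L w)) \<and>
     (\<forall>v\<in>D. \<forall>w\<in>D. \<forall>a b. (\<lambda>x. a * v x + b * w x) \<in> D \<and>
        L2_eq (L (\<lambda>x. a * v x + b * w x)) (\<lambda>x. a * L v x + b * L w x))"

text \<open>The last clause says that the graphs of \<open>L\<close> and of its adjoint coincide.\<close>

definition self_adjoint :: "'d::finite field set \<Rightarrow> ('d field \<Rightarrow> 'd field) \<Rightarrow> bool" where
  "self_adjoint D L \<longleftrightarrow>
     L2_operator D L \<and>
     (\<forall>v\<in>L2_fun. \<forall>\<epsilon>>0. \<exists>w\<in>D. L2_norm (\<lambda>x. v x - w x) < \<epsilon>) \<and>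
     (\<forall>w\<in>L2_fun. \<forall>g\<in>L2_fun.
        (\<forall>v\<in>D. L2_inner (L v) w = L2_inner v g) \<longleftrightarrow> w \<in> D \<and> L2_eq (L w) g)"

definition partial_deriv :: "'d::finite \<Rightarrow> 'd field \<Rightarrow> 'd field" where
  "partial_deriv i v x = vector_derivative (\<lambda>r. v (x + axis i r)) (at 0)"

definition partial_derivs :: "'d::finite list \<Rightarrow> 'd field \<Rightarrow> 'd field" where
  "partial_derivs ds v = foldr partial_deriv ds v"

definition smooth_fun :: "'d::finite field \<Rightarrow> bool" where
  "smooth_fun v \<longleftrightarrow> periodic v \<and> (\<forall>ds x. partial_derivs ds v differentiable (at x))"

text \<open>
  Multi-indices are written as lists of directions.  The differential expression is prescribed on
  smooth functions only; if \<open>L\<close> is also self-adjoint, testing \<open>L v\<close> against smooth functions shows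
  that \<open>L\<close> acts by the same expression, in the weak sense, on all of \<open>D\<close>.
\<close>

definition differential_operator :: "'d::finite field set \<Rightarrow> ('d field \<Rightarrow> 'd field) \<Rightarrow> bool" where
  "differential_operator D L \<longleftrightarrow>
     (\<exists>m a. (\<forall>ds. a ds \<in> L2_fun) \<and>
        (\<forall>\<phi>. smooth_fun \<phi> \<longrightarrow> \<phi> \<in> D \<and>
           L2_eq (L \<phi>) (\<lambda>x. \<Sum>ds | length ds \<le> m. a ds x * partial_derivs ds \<phi> x)))"

lemma finite_multi_indices: "finite {ds :: 'd::finite list. length ds \<le> m}"
  using finite_lists_length_le[of "UNIV :: 'd set" m] by simp

section \<open>The equation and its linearisation\<close>

definition potential :: "(real \<Rightarrow> real) \<Rightarrow> 'd::finite field \<Rightarrow> 'd field \<Rightarrow> 'd field" where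
  "potential f v z = (\<lambda>x. of_real (f (cmod (v x))) * z x)"

definition G_op :: "('d::finite field \<Rightarrow> 'd field) \<Rightarrow> (real \<Rightarrow> real) \<Rightarrow> 'd field \<Rightarrow> 'd field \<Rightarrow> 'd field"
  where "G_op L f v z = (\<lambda>x. L z x + potential f v z x)"

definition H_op :: "('d::finite field \<Rightarrow> 'd field) \<Rightarrow> (real \<Rightarrow> real) \<Rightarrow> 'd field \<Rightarrow> 'd field" where
  "H_op L f u = G_op L f u u"

definition has_L2_derivative ::
    "(real \<Rightarrow> 'd::finite field) \<Rightarrow> 'd field \<Rightarrow> real \<Rightarrow> real set \<Rightarrow> bool" where
  "has_L2_derivative v v' t T \<longleftrightarrow>
     ((\<lambda>s. L2_norm (\<lambda>x. (v s x - v t x) / of_real (s - t) - v' x)) \<longlongrightarrow> 0) (at t within T)"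

text \<open>\<open>v\<close> is a strong solution of \<open>\<i> \<partial>\<^sub>t v = F t v\<close> on \<open>T\<close> with values in \<open>D\<close>.\<close>

definition solves :: "'d::finite field set \<Rightarrow> (real \<Rightarrow> 'd field \<Rightarrow> 'd field) \<Rightarrow> real set \<Rightarrow>
    (real \<Rightarrow> 'd field) \<Rightarrow> bool" where
  "solves D F T v \<longleftrightarrow>
     (\<forall>t\<in>T. v t \<in> D) \<and>
     (\<forall>t\<in>T. \<exists>v'\<in>L2_fun. has_L2_derivative v v' t T \<and> L2_eq (\<lambda>x. \<i> * v' x) (F t (v t)))"

text \<open>
  A number \<open>K\<close> that serves as \<open>G'(v)\<close>, where \<open>\<Delta>\<close> is the range of small perturbations for which
  the inequality holds, for instance a small \<open>L\<^sub>2\<close> ball in \<open>H\<^sup>2\<close>.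
\<close>

definition frechet_bound :: "'d::finite field set \<Rightarrow> ('d field \<Rightarrow> 'd field) \<Rightarrow> (real \<Rightarrow> real) \<Rightarrow>
    'd field set \<Rightarrow> 'd field \<Rightarrow> real \<Rightarrow> bool" where
  "frechet_bound D L f \<Delta> v K \<longleftrightarrow>
     0 < K \<and> v \<in> Sobolev 2 \<and> \<Delta> \<subseteq> Sobolev 2 \<and>
     (\<forall>\<delta>\<in>\<Delta>. L2_op_norm D (\<lambda>z x. G_op L f (\<lambda>y. v y + \<delta> y) z x - G_op L f v z x)
                \<le> ennreal (K * L2_norm \<delta>))"

section \<open>Strang splitting\<close>

text \<open>
  \<open>z\<close> is the result of a step of length \<open>\<sigma>\<close> from \<open>a\<close>; the middle equation is
  \<open>\<i> \<partial>\<^sub>t v\<^sub>2 = N w v\<^sub>2\<close>, where \<open>w\<close> is the end value of the first sub-step.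
\<close>

definition strang_step :: "'d::finite field set \<Rightarrow> ('d field \<Rightarrow> 'd field) \<Rightarrow>
    ('d field \<Rightarrow> 'd field \<Rightarrow> 'd field) \<Rightarrow> real \<Rightarrow> 'd field \<Rightarrow> 'd field \<Rightarrow> bool" where
  "strang_step D L N \<sigma> a z \<longleftrightarrow>
     (\<exists>v1 v2 v3 w.
        solves D (\<lambda>_. L) {0..\<sigma>/2} v1 \<and> L2_eq (v1 0) a \<and> w = v1 (\<sigma>/2) \<and>
        solves L2_fun (\<lambda>_. N w) {0..\<sigma>} v2 \<and> L2_eq (v2 0) w \<and>
        solves D (\<lambda>_. L) {0..\<sigma>/2} v3 \<and> L2_eq (v3 0) (v2 \<sigma>) \<and> z = v3 (\<sigma>/2))"

definition strang_nonlinear where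
  "strang_nonlinear D L f = strang_step D L (\<lambda>w y. potential f y y)"

definition strang_frozen where
  "strang_frozen D L f = strang_step D L (\<lambda>w y. potential f w y)"

section \<open>Order\<close>

text \<open>
  The error \<open>\<rho>\<close> is at most \<open>c h\<^sup>p\<^sup>+\<^sup>1\<close> on \<open>[t\<^sub>n, t\<^sub>n + h]\<close>, with one constant \<open>c\<close> for all step sizes \<open>h\<close>
  in the given set.  A singleton set treats one fixed step; a set such as \<open>{0<..h\<^sub>0}\<close> treats the
  limit \<open>h \<rightarrow> 0\<close>.
\<close>

definition has_order :: "real set \<Rightarrow> real \<Rightarrow> (real \<Rightarrow> real) \<Rightarrow> nat \<Rightarrow> bool" where
  "has_order steps tn \<rho> p \<longleftrightarrow> (\<exists>c>0. \<forall>h\<in>steps. \<forall>t\<in>{tn..tn+h}. \<rho> t \<le> c * h ^ (p + 1))"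

end

theory Submission
  imports Defs
begin

text \<open>
  The first iterate costs nothing beyond the splitting error.  In the sub-step
  \<open>\<i> \<partial>\<^sub>t v\<^sub>2 = f(|v\<^sub>2|) v\<^sub>2\<close> of Strang splitting the potential is real and acts pointwise, so
  \<open>|v\<^sub>2|\<close> is constant in time (\<open>nonlinear_flow_modulus\<close>) and \<open>f(|v\<^sub>2|)\<close> may be frozen at its initial
  value without changing the solution.  The frozen splitting therefore coincides with the ordinary
  one (\<open>strang_frozen_eq_nonlinear\<close>), and \<open>\<rho>\<^sub>1\<close> is its local error, at most \<open>c\<^sub>1 h\<^sup>3\<close>.

  Each further iterate gains one power of \<open>h\<close>.  The error \<open>e = u\<^sup>[\<^sup>k\<^sup>+\<^sup>1\<^sup>] - u\<close> vanishes at \<open>t\<^sub>n\<close> and solves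
  \<open>\<i> \<partial>\<^sub>t e = G(u\<^sup>[\<^sup>k\<^sup>]) e + (G(u\<^sup>[\<^sup>k\<^sup>]) - G(u)) u\<close>.
  The operator \<open>G(u\<^sup>[\<^sup>k\<^sup>])\<close> is symmetric, hence multiplied by \<open>-\<i>\<close> it does not contribute to
  \<open>\<partial>\<^sub>t \<parallel>e\<parallel>\<^sup>2 = 2 Re \<langle>\<partial>\<^sub>t e, e\<rangle>\<close>, and \<open>\<parallel>e\<parallel>\<close> grows at most at the rate of the norm of the source term.
  By the Frechet bound that norm is at most \<open>G' \<rho>\<^sub>k \<parallel>u\<parallel>\<close>, where \<open>\<parallel>u\<parallel>\<close> is conserved, so that
  \<open>\<rho>\<^sub>k\<^sub>+\<^sub>1 \<le> h G' \<parallel>u\<parallel> sup \<rho>\<^sub>k\<close> (\<open>iteration_error_step\<close>).  The estimate follows by induction on \<open>k\<close>; it is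
  geometric in \<open>k\<close> with ratio \<open>h G' \<parallel>u\<parallel>\<close>, whence the convergence.

  Uniqueness of the sub-steps, conservation of \<open>|v\<^sub>2|\<close> and of \<open>\<parallel>u\<parallel>\<close>, and the growth of the error are
  all instances of one principle, \<open>perturbed_conservative_norm_growth\<close>: along
  \<open>\<i> e' = l + p e + g\<close> with \<open>\<langle>l, e\<rangle>\<close> and \<open>p\<close> real, the norm of \<open>e\<close> changes at most at the rate \<open>\<parallel>g\<parallel>\<close>.
\<close>

section \<open>Square-integrable functions\<close>

text \<open>
  Periodicity is dropped from \<open>L2_fun\<close> so that the class is closed under restriction to an arbitrary
  measurable set, on which the pointwise modulus is tested below.
\<close>

definition sq_integrable :: "'d::finite field \<Rightarrow> bool" where
  "sq_integrable v \<longleftrightarrow> v \<in> borel_measurable torus \<and> integrable torus (\<lambda>x. (cmod (v x))\<^sup>2)"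

lemma L2_fun_sq_integrable: "v \<in> L2_fun \<Longrightarrow> sq_integrable v"
  by (simp add: L2_fun_def sq_integrable_def)

lemma sq_integrable_zero [simp]: "sq_integrable (\<lambda>_. 0)"
  by (simp add: sq_integrable_def)

lemma sq_integrable_mult_const:
  assumes "sq_integrable v"
  shows "sq_integrable (\<lambda>x. c * v x)"
  using assms borel_measurable_times[OF borel_measurable_const, of v torus c]
  by (simp add: sq_integrable_def norm_mult power_mult_distrib)

lemma sq_integrable_add:
  assumes "sq_integrable v" "sq_integrable w"
  shows "sq_integrable (\<lambda>x. v x + w x)"
proof -
  have m: "v \<in> borel_measurable torus" "w \<in> borel_measurable torus"
    using assms by (auto simp: sq_integrable_def)
  have "integrable torus (\<lambda>x. 2 * (cmod (v x))\<^sup>2 + 2 * (cmod (w x))\<^sup>2)"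
    using assms by (simp add: sq_integrable_def)
  moreover have "(cmod (v x + w x))\<^sup>2 \<le> 2 * (cmod (v x))\<^sup>2 + 2 * (cmod (w x))\<^sup>2" for x
  proof -
    have "(cmod (v x + w x))\<^sup>2 \<le> (cmod (v x) + cmod (w x))\<^sup>2"
      by (intro power_mono norm_triangle_ineq) simp
    also have "\<dots> \<le> 2 * (cmod (v x))\<^sup>2 + 2 * (cmod (w x))\<^sup>2"
      using sum_squares_bound[of "cmod (v x)" "cmod (w x)"] by (simp add: power2_sum)
    finally show ?thesis .
  qed
  ultimately have "integrable torus (\<lambda>x. (cmod (v x + w x))\<^sup>2)"
    using m by (elim Bochner_Integration.integrable_bound) auto
  then show ?thesis
    using m by (simp add: sq_integrable_def)
qed

lemma sq_integrable_diff:
  assumes "sq_integrable v" "sq_integrable w"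
  shows "sq_integrable (\<lambda>x. v x - w x)"
  using sq_integrable_add[OF assms(1) sq_integrable_mult_const[OF assms(2), of "-1"]] by simp

lemma sq_integrable_restrict:
  assumes "sq_integrable v" "A \<in> sets torus"
  shows "sq_integrable (\<lambda>x. of_real (indicator A x) * v x)"
proof -
  have m [measurable]: "v \<in> borel_measurable torus" "A \<in> sets torus"
    using assms by (auto simp: sq_integrable_def)
  have "integrable torus (\<lambda>x. (cmod (of_real (indicator A x) * v x))\<^sup>2)"
  proof (rule Bochner_Integration.integrable_bound)
    show "integrable torus (\<lambda>x. (cmod (v x))\<^sup>2)"
      using assms by (simp add: sq_integrable_def)
  qed (auto simp: indicator_def)
  then show ?thesis
    by (simp add: sq_integrable_def)
qed

lemma integrable_product:
  assumes "sq_integrable v" "sq_integrable w"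
  shows "integrable torus (\<lambda>x. v x * cnj (w x))"
proof (rule Bochner_Integration.integrable_bound)
  show "integrable torus (\<lambda>x. (cmod (v x))\<^sup>2 + (cmod (w x))\<^sup>2)"
    using assms by (simp add: sq_integrable_def)
  have m: "v \<in> borel_measurable torus" "w \<in> borel_measurable torus"
    using assms by (auto simp: sq_integrable_def)
  have "(\<lambda>x. cnj (w x)) \<in> borel_measurable torus"
    by (rule measurable_compose[OF m(2)]) (intro borel_measurable_continuous_onI continuous_intros)
  with m show "(\<lambda>x. v x * cnj (w x)) \<in> borel_measurable torus"
    by simp
  have "cmod (v x) * cmod (w x) \<le> (cmod (v x))\<^sup>2 + (cmod (w x))\<^sup>2" for x
    using sum_squares_bound[of "cmod (v x)" "cmod (w x)"]
      mult_nonneg_nonneg[of "cmod (v x)" "cmod (w x)"] by (simp del: mult_nonneg_nonneg)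
  then show "AE x in torus. norm (v x * cnj (w x)) \<le> norm ((cmod (v x))\<^sup>2 + (cmod (w x))\<^sup>2)"
    by (simp add: norm_mult)
qed

lemma L2_norm_nonneg [simp]: "0 \<le> L2_norm v"
  by (simp add: L2_norm_def)

lemma L2_norm_zero [simp]: "L2_norm (\<lambda>_. 0) = 0"
  by (simp add: L2_norm_def)

lemma L2_norm_sq: "(L2_norm v)\<^sup>2 = (LINT x|torus. (cmod (v x))\<^sup>2)"
  by (simp add: L2_norm_def)

lemma L2_norm_mult_const: "L2_norm (\<lambda>x. c * v x) = cmod c * L2_norm v"
  by (simp add: L2_norm_def norm_mult power_mult_distrib real_sqrt_mult)

lemma L2_norm_cong_AE:
  assumes "AE x in torus. v x = w x" "sq_integrable v" "sq_integrable w"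
  shows "L2_norm v = L2_norm w"
proof -
  have "(LINT x|torus. (cmod (v x))\<^sup>2) = (LINT x|torus. (cmod (w x))\<^sup>2)"
    using assms by (intro integral_cong_AE) (auto simp: sq_integrable_def)
  then show ?thesis
    by (simp add: L2_norm_def)
qed

lemma L2_norm_eq_0_imp_AE:
  assumes "sq_integrable v" "L2_norm v = 0"
  shows "AE x in torus. v x = 0"
proof -
  have "(LINT x|torus. (cmod (v x))\<^sup>2) = 0"
    using assms(2) L2_norm_sq[of v] by simp
  then have "AE x in torus. (cmod (v x))\<^sup>2 = 0"
    using assms(1) by (subst (asm) integral_nonneg_eq_0_iff_AE) (auto simp: sq_integrable_def)
  then show ?thesis
    by simp
qed

lemma L2_inner_add_left:
  assumes "sq_integrable v" "sq_integrable w" "sq_integrable z"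
  shows "L2_inner (\<lambda>x. v x + w x) z = L2_inner v z + L2_inner w z"
  using assms by (simp add: L2_inner_def distrib_right integrable_product)

lemma L2_inner_mult_left: "L2_inner (\<lambda>x. c * v x) w = c * L2_inner v w"
  by (simp add: L2_inner_def mult.assoc)

lemma L2_inner_commute: "L2_inner w v = cnj (L2_inner v w)"
proof -
  have "cnj (L2_inner v w) = (LINT x|torus. cnj (v x * cnj (w x)))"
    by (simp only: L2_inner_def Bochner_Integration.integral_cnj)
  then show ?thesis
    by (simp add: L2_inner_def mult.commute)
qed

lemma L2_norm_sq_add:
  assumes "sq_integrable v" "sq_integrable w"
  shows "(L2_norm (\<lambda>x. v x + w x))\<^sup>2 = (L2_norm v)\<^sup>2 + 2 * Re (L2_inner w v) + (L2_norm w)\<^sup>2"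
proof -
  have i: "integrable torus (\<lambda>x. w x * cnj (v x))"
    using assms integrable_product by blast
  have "(cmod (v x + w x))\<^sup>2 = (cmod (v x))\<^sup>2 + 2 * Re (w x * cnj (v x)) + (cmod (w x))\<^sup>2" for x
    unfolding cmod_power2 by (simp add: power2_eq_square algebra_simps)
  then have "(L2_norm (\<lambda>x. v x + w x))\<^sup>2 =
      (LINT x|torus. (cmod (v x))\<^sup>2 + 2 * Re (w x * cnj (v x)) + (cmod (w x))\<^sup>2)"
    by (simp only: L2_norm_sq)
  also have "\<dots> = (L2_norm v)\<^sup>2 + 2 * (LINT x|torus. Re (w x * cnj (v x))) + (L2_norm w)\<^sup>2"
    using assms integrable_Re[OF i] unfolding L2_norm_sq sq_integrable_def
    by (simp del: times_complex.sel)
  also have "(LINT x|torus. Re (w x * cnj (v x))) = Re (L2_inner w v)"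
    using i unfolding L2_inner_def by (rule integral_Re)
  finally show ?thesis .
qed

text \<open>
  Passing to moduli reduces this to the Cauchy-Schwarz inequality for nonnegative integrals.
\<close>

lemma L2_Cauchy_Schwarz:
  assumes "sq_integrable v" "sq_integrable w"
  shows "cmod (L2_inner v w) \<le> L2_norm v * L2_norm w"
proof -
  have [measurable]: "v \<in> borel_measurable torus" "w \<in> borel_measurable torus"
    using assms by (auto simp: sq_integrable_def)
  define I where "I = (LINT x|torus. cmod (v x) * cmod (w x))"
  have int: "integrable torus (\<lambda>x. cmod (v x) * cmod (w x))"
    using integrable_norm[OF integrable_product[OF assms]] by (simp add: norm_mult)
  have I0: "0 \<le> I"
    by (simp add: I_def)
  have "ennreal (I\<^sup>2) = (\<integral>\<^sup>+x. ennreal (cmod (v x)) * ennreal (cmod (w x)) \<partial>torus)\<^sup>2"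
    using int by (simp add: I_def nn_integral_eq_integral flip: ennreal_mult' ennreal_power)
  also have "\<dots> \<le> (\<integral>\<^sup>+x. (ennreal (cmod (v x)))\<^sup>2 \<partial>torus) * (\<integral>\<^sup>+x. (ennreal (cmod (w x)))\<^sup>2 \<partial>torus)"
    by (rule Cauchy_Schwarz_nn_integral) auto
  also have "\<dots> = ennreal ((L2_norm v)\<^sup>2 * (L2_norm w)\<^sup>2)"
    using assms unfolding L2_norm_sq
    by (simp add: sq_integrable_def ennreal_power nn_integral_eq_integral ennreal_mult')
  finally have "I\<^sup>2 \<le> (L2_norm v * L2_norm w)\<^sup>2"
    by (simp add: power_mult_distrib)
  then have "I \<le> L2_norm v * L2_norm w"
    by (rule power2_le_imp_le) simp
  moreover have "cmod (L2_inner v w) \<le> I"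
    unfolding L2_inner_def I_def
    using integral_norm_bound[of torus "\<lambda>x. v x * cnj (w x)"] by (simp add: norm_mult)
  ultimately show ?thesis
    by simp
qed

lemma L2_norm_triangle:
  assumes "sq_integrable v" "sq_integrable w"
  shows "L2_norm (\<lambda>x. v x + w x) \<le> L2_norm v + L2_norm w"
proof (rule power2_le_imp_le)
  have "Re (L2_inner w v) \<le> L2_norm v * L2_norm w"
    using complex_Re_le_cmod[of "L2_inner w v"] L2_Cauchy_Schwarz[OF assms(2,1)]
    by (simp add: mult.commute)
  then show "(L2_norm (\<lambda>x. v x + w x))\<^sup>2 \<le> (L2_norm v + L2_norm w)\<^sup>2"
    using L2_norm_sq_add[OF assms] by (simp add: power2_sum)
qed simp

lemma L2_eq_sym: "L2_eq v w \<Longrightarrow> L2_eq w v"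
  unfolding L2_eq_def by (auto elim: eventually_mono)

lemma L2_eq_trans:
  assumes "L2_eq v w" "L2_eq w z"
  shows "L2_eq v z"
  using assms unfolding L2_eq_def by eventually_elim simp

lemma L2_eq_iff_norm_diff:
  assumes "sq_integrable v" "sq_integrable w"
  shows "L2_eq v w \<longleftrightarrow> L2_norm (\<lambda>x. v x - w x) = 0"
proof
  assume "L2_eq v w"
  then have "AE x in torus. v x - w x = 0"
    by (simp add: L2_eq_def)
  then show "L2_norm (\<lambda>x. v x - w x) = 0"
    using L2_norm_cong_AE[of "\<lambda>x. v x - w x" "\<lambda>_. 0"] sq_integrable_diff[OF assms] by simp
next
  assume "L2_norm (\<lambda>x. v x - w x) = 0"
  then show "L2_eq v w"
    using L2_norm_eq_0_imp_AE[OF sq_integrable_diff[OF assms]] by (simp add: L2_eq_def)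
qed

section \<open>Growth of the norm along a perturbed conservative flow\<close>

lemma has_L2_derivative_subset:
  "has_L2_derivative v v' t T \<Longrightarrow> T' \<subseteq> T \<Longrightarrow> has_L2_derivative v v' t T'"
  unfolding has_L2_derivative_def by (rule tendsto_within_subset)

text \<open>The difference quotients subtract, so the triangle inequality bounds the remainder.\<close>

lemma has_L2_derivative_diff:
  assumes v: "has_L2_derivative v v' t T" "\<And>s. s \<in> T \<Longrightarrow> sq_integrable (v s)" "sq_integrable v'"
    and w: "has_L2_derivative w w' t T" "\<And>s. s \<in> T \<Longrightarrow> sq_integrable (w s)" "sq_integrable w'"
    and t: "t \<in> T"
  shows "has_L2_derivative (\<lambda>s x. v s x - w s x) (\<lambda>x. v' x - w' x) t T"
proof -
  define q where "q z z' s x = (z s x - z t x) / of_real (s - t) - z' x"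
    for z :: "real \<Rightarrow> 'a field" and z' :: "'a field" and s x
  have sq: "sq_integrable (q z z' s)"
    if "\<And>s. s \<in> T \<Longrightarrow> sq_integrable (z s)" "sq_integrable z'" "s \<in> T" for z z' s
  proof -
    have "sq_integrable (\<lambda>x. inverse (of_real (s - t)) * (z s x - z t x) - z' x)"
      by (intro sq_integrable_diff sq_integrable_mult_const that t)
    then show ?thesis
      by (simp add: q_def[abs_def] divide_inverse mult.commute)
  qed
  have lim: "((\<lambda>s. L2_norm (q v v' s) + L2_norm (q w w' s)) \<longlongrightarrow> 0) (at t within T)"
    using tendsto_add[OF v(1)[unfolded has_L2_derivative_def] w(1)[unfolded has_L2_derivative_def]]
    by (simp add: q_def[abs_def])
  have le: "L2_norm (\<lambda>x. ((v s x - w s x) - (v t x - w t x)) / of_real (s - t) - (v' x - w' x))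
      \<le> L2_norm (q v v' s) + L2_norm (q w w' s)" if "s \<in> T" for s
  proof -
    have "L2_norm (\<lambda>x. q v v' s x + (-1) * q w w' s x)
        \<le> L2_norm (q v v' s) + L2_norm (\<lambda>x. (-1) * q w w' s x)"
      using that sq v w by (intro L2_norm_triangle sq_integrable_mult_const) auto
    also have "L2_norm (\<lambda>x. (-1) * q w w' s x) = L2_norm (q w w' s)"
      by (subst L2_norm_mult_const) simp
    finally have "L2_norm (\<lambda>x. q v v' s x - q w w' s x)
        \<le> L2_norm (q v v' s) + L2_norm (q w w' s)"
      by simp
    moreover have "(\<lambda>x. ((v s x - w s x) - (v t x - w t x)) / of_real (s - t) - (v' x - w' x))
        = (\<lambda>x. q v v' s x - q w w' s x)"
      by (simp add: q_def fun_eq_iff diff_divide_distrib)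
    ultimately show ?thesis
      by simp
  qed
  have "\<forall>\<^sub>F s in at t within T. s \<in> T"
    by (simp add: eventually_at_filter)
  then show ?thesis
    unfolding has_L2_derivative_def
    by (intro tendsto_sandwich[OF _ _ tendsto_const lim])
       (auto elim!: eventually_mono simp del: of_real_diff intro: le)
qed

text \<open>
  Write \<open>q\<close> for the error of the difference quotient.  Then \<open>e s = e t + (s - t) (e' + q)\<close>, and the
  square of the norm expands into the claimed linear term, a term bounded by \<open>\<parallel>q\<parallel> \<parallel>e t\<parallel>\<close> and a term
  of second order in \<open>s - t\<close>.
\<close>

lemma L2_norm_sq_derivative:
  assumes e: "\<And>s. s \<in> T \<Longrightarrow> sq_integrable (e s)" and e': "sq_integrable e'" and t: "t \<in> T"
    and d: "has_L2_derivative e e' t T"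
  shows "((\<lambda>s. (L2_norm (e s))\<^sup>2) has_real_derivative 2 * Re (L2_inner e' (e t))) (at t within T)"
proof -
  define q where "q s x = (e s x - e t x) / of_real (s - t) - e' x" for s x
  define N where "N s = L2_norm (q s)" for s
  have q_lim: "(N \<longlongrightarrow> 0) (at t within T)"
    using d by (simp add: has_L2_derivative_def N_def[abs_def] q_def[abs_def])
  have bound: "\<bar>((L2_norm (e s))\<^sup>2 - (L2_norm (e t))\<^sup>2) / (s - t) - 2 * Re (L2_inner e' (e t))\<bar>
      \<le> 2 * (N s * L2_norm (e t)) + \<bar>s - t\<bar> * (L2_norm e' + N s)\<^sup>2"
    if s: "s \<in> T" "s \<noteq> t" for s
  proof -
    have "sq_integrable (\<lambda>x. inverse (of_real (s - t)) * (e s x - e t x) - e' x)"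
      by (intro sq_integrable_diff sq_integrable_mult_const e e' t s)
    then have q: "sq_integrable (q s)"
      by (simp add: q_def[abs_def] divide_inverse mult.commute)
    define p where "p x = e' x + q s x" for x
    have p: "sq_integrable p"
      unfolding p_def[abs_def] by (intro sq_integrable_add e' q)
    have "e s x = e t x + of_real (s - t) * p x" for x
      using s by (simp add: p_def q_def field_simps del: of_real_diff)
    then have "e s = (\<lambda>x. e t x + of_real (s - t) * p x)"
      by (rule ext)
    then have "(L2_norm (e s))\<^sup>2 = (L2_norm (e t))\<^sup>2
        + 2 * ((s - t) * Re (L2_inner p (e t))) + ((s - t) * L2_norm p)\<^sup>2"
      using L2_norm_sq_add[OF e[OF t] sq_integrable_mult_const[OF p, of "of_real (s - t)"]]
      by (simp add: L2_inner_mult_left L2_norm_mult_const power_mult_distrib del: of_real_diff)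
    then have "((L2_norm (e s))\<^sup>2 - (L2_norm (e t))\<^sup>2) / (s - t)
        = 2 * Re (L2_inner p (e t)) + (s - t) * (L2_norm p)\<^sup>2"
      using s by (simp add: field_simps power2_eq_square)
    also have "L2_inner p (e t) = L2_inner e' (e t) + L2_inner (q s) (e t)"
      unfolding p_def[abs_def] by (intro L2_inner_add_left e' q e t)
    finally have "((L2_norm (e s))\<^sup>2 - (L2_norm (e t))\<^sup>2) / (s - t) - 2 * Re (L2_inner e' (e t))
        = 2 * Re (L2_inner (q s) (e t)) + (s - t) * (L2_norm p)\<^sup>2"
      by simp
    moreover have "\<bar>Re (L2_inner (q s) (e t))\<bar> \<le> N s * L2_norm (e t)"
      unfolding N_def using abs_Re_le_cmod L2_Cauchy_Schwarz[OF q e[OF t]] order_trans by blast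
    moreover have "\<bar>(s - t) * (L2_norm p)\<^sup>2\<bar> \<le> \<bar>s - t\<bar> * (L2_norm e' + N s)\<^sup>2"
      unfolding abs_mult N_def p_def[abs_def] using L2_norm_triangle[OF e' q]
      by (intro mult_mono) (auto intro: power_mono)
    ultimately show ?thesis
      by linarith
  qed
  have "((\<lambda>s. 2 * (N s * L2_norm (e t)) + \<bar>s - t\<bar> * (L2_norm e' + N s)\<^sup>2) \<longlongrightarrow>
      2 * (0 * L2_norm (e t)) + \<bar>t - t\<bar> * (L2_norm e' + 0)\<^sup>2) (at t within T)"
    by (intro tendsto_intros q_lim)
  then have lim: "((\<lambda>s. 2 * (N s * L2_norm (e t)) + \<bar>s - t\<bar> * (L2_norm e' + N s)\<^sup>2) \<longlongrightarrow> 0)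
      (at t within T)"
    by simp
  have "((\<lambda>s. ((L2_norm (e s))\<^sup>2 - (L2_norm (e t))\<^sup>2) / (s - t) - 2 * Re (L2_inner e' (e t))) \<longlongrightarrow> 0)
      (at t within T)"
    by (rule Lim_null_comparison[OF _ lim]) (auto simp: eventually_at_filter bound)
  then show ?thesis
    unfolding has_field_derivative_iff by (rule LIM_zero_cancel)
qed

text \<open>
  The flow solves \<open>\<i> e' = l + p e + g\<close>, where \<open>l\<close> stands for \<open>L e\<close> with a symmetric \<open>L\<close>, of which only
  the reality of \<open>\<langle>l, e\<rangle>\<close> is kept, \<open>p\<close> for a real potential, possibly depending on time and on the
  solution, and \<open>g\<close> for a source of norm at most \<open>M\<close>.
\<close>

definition perturbed_conservative :: "real \<Rightarrow> real set \<Rightarrow> (real \<Rightarrow> 'd::finite field) \<Rightarrow> bool" where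
  "perturbed_conservative M T e \<longleftrightarrow>
     (\<forall>t\<in>T. sq_integrable (e t) \<and>
       (\<exists>e' l p g. sq_integrable e' \<and> sq_integrable l \<and> sq_integrable g \<and>
          has_L2_derivative e e' t T \<and> Im (L2_inner l (e t)) = 0 \<and> L2_norm g \<le> M \<and>
          (AE x in torus. \<i> * e' x = l x + of_real (p x) * e t x + g x)))"

lemma perturbed_conservative_subset:
  "perturbed_conservative M T e \<Longrightarrow> T' \<subseteq> T \<Longrightarrow> perturbed_conservative M T' e"
  unfolding perturbed_conservative_def by (meson has_L2_derivative_subset subsetD)

text \<open>
  \<open>Re \<langle>e', e\<rangle> = Im \<langle>\<i> e', e\<rangle>\<close>, and on the right-hand side of the equation only \<open>\<langle>g, e\<rangle>\<close> can have an
  imaginary part.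
\<close>

lemma perturbed_conservative_pairing:
  assumes sq: "sq_integrable e" "sq_integrable e'" "sq_integrable l" "sq_integrable g"
    and l: "Im (L2_inner l e) = 0"
    and eq: "AE x in torus. \<i> * e' x = l x + of_real (p x) * e x + g x"
  shows "\<bar>Re (L2_inner e' e)\<bar> \<le> L2_norm g * L2_norm e"
proof -
  \<comment> \<open>\<open>p\<close> need not be measurable; expressed by the other terms of the equation, \<open>p e\<close> is
      seen to be square-integrable.\<close>
  define P where "P x = \<i> * e' x + (-1) * (l x + g x)" for x
  have lg: "sq_integrable (\<lambda>x. l x + g x)"
    by (intro sq_integrable_add sq)
  have P: "sq_integrable P"
    unfolding P_def[abs_def] by (intro sq_integrable_add sq_integrable_mult_const sq lg)
  have int: "integrable torus (\<lambda>x. P x * cnj (e x))"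
    by (intro integrable_product P sq)
  have "AE x in torus. Im (P x * cnj (e x)) = 0"
    using eq by eventually_elim (simp add: P_def mult.assoc complex_mult_cnj)
  then have "(LINT x|torus. Im (P x * cnj (e x))) = 0"
    by (rule integral_eq_zero_AE)
  then have "Im (L2_inner P e) = 0"
    using integral_Im[OF int] by (simp add: L2_inner_def)
  moreover have "L2_inner P e = \<i> * L2_inner e' e + (-1) * (L2_inner l e + L2_inner g e)"
    unfolding P_def[abs_def]
    by (subst L2_inner_add_left)
       (simp_all only: L2_inner_mult_left L2_inner_add_left sq lg sq_integrable_mult_const)
  ultimately have "Re (L2_inner e' e) = Im (L2_inner g e)"
    using l by simp
  then show ?thesis
    using abs_Im_le_cmod[of "L2_inner g e"] L2_Cauchy_Schwarz[OF sq(4,1)] by simp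
qed

text \<open>
  Formally, \<open>2 \<parallel>e\<parallel> \<parallel>e\<parallel>' = (\<parallel>e\<parallel>\<^sup>2)'\<close> is bounded by \<open>2 M \<parallel>e\<parallel>\<close> in
  absolute value.  With \<open>M = 0\<close> the lemma is a conservation law, and applied to the difference of two
  solutions it is a uniqueness theorem.
\<close>

lemma perturbed_conservative_norm_growth:
  assumes e: "perturbed_conservative M {a..b} e" and st: "a \<le> s" "s \<le> t" "t \<le> b"
  shows "\<bar>L2_norm (e t) - L2_norm (e s)\<bar> \<le> M * (t - s)"
proof (cases "s < t")
  case False
  then show ?thesis
    using st by simp
next
  case True
  have e: "perturbed_conservative M {s..t} e"
    using e by (rule perturbed_conservative_subset) (use st in auto)
  have M: "0 \<le> M"
    using e True L2_norm_nonneg order_trans unfolding perturbed_conservative_def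
    by (metis atLeastAtMost_iff order_refl less_imp_le)
  have "\<exists>c. ((\<lambda>r. (L2_norm (e r))\<^sup>2) has_real_derivative 2 * c) (at r within {s..t})
      \<and> \<bar>c\<bar> \<le> M * L2_norm (e r)" if r: "r \<in> {s..t}" for r
  proof -
    obtain e' l p g where *: "sq_integrable e'" "sq_integrable l" "sq_integrable g"
      "has_L2_derivative e e' r {s..t}" "Im (L2_inner l (e r)) = 0" "L2_norm g \<le> M"
      "AE x in torus. \<i> * e' x = l x + of_real (p x) * e r x + g x"
      using e r unfolding perturbed_conservative_def by blast
    have sq: "sq_integrable (e r)" if "r \<in> {s..t}" for r
      using e that unfolding perturbed_conservative_def by blast
    have "\<bar>Re (L2_inner e' (e r))\<bar> \<le> L2_norm g * L2_norm (e r)"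
      using perturbed_conservative_pairing[OF sq[OF r] *(1,2,3,5,7)] .
    also have "\<dots> \<le> M * L2_norm (e r)"
      using *(6) by (intro mult_right_mono) auto
    finally show ?thesis
      using L2_norm_sq_derivative[OF sq *(1) r *(4)] by blast
  qed
  then obtain c where c: "\<And>r. r \<in> {s..t} \<Longrightarrow>
      ((\<lambda>r. (L2_norm (e r))\<^sup>2) has_real_derivative 2 * c r) (at r within {s..t})"
    "\<And>r. r \<in> {s..t} \<Longrightarrow> \<bar>c r\<bar> \<le> M * L2_norm (e r)"
    by metis
  \<comment> \<open>The norm itself may fail to be differentiable where it vanishes, so \<open>\<epsilon>\<close> is added under the
      root and removed in the limit.\<close>
  have reg: "\<bar>sqrt ((L2_norm (e t))\<^sup>2 + \<epsilon>) - sqrt ((L2_norm (e s))\<^sup>2 + \<epsilon>)\<bar> \<le> M * (t - s)"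
    if "0 < \<epsilon>" for \<epsilon>
  proof -
    define R where "R r = sqrt ((L2_norm (e r))\<^sup>2 + \<epsilon>)" for r
    have pos: "0 < (L2_norm (e r))\<^sup>2 + \<epsilon>" for r
      using that by (simp add: add_nonneg_pos)
    have R: "0 < R r" for r
      using pos by (simp add: R_def)
    have "(R has_real_derivative c r / R r) (at r within {s..t})" if "r \<in> {s..t}" for r
    proof -
      have "((\<lambda>r. (L2_norm (e r))\<^sup>2 + \<epsilon>) has_real_derivative 2 * c r) (at r within {s..t})"
        using DERIV_add[OF c(1)[OF that] DERIV_const[of \<epsilon>]] by simp
      from DERIV_chain2[OF DERIV_real_sqrt[OF pos] this] show ?thesis
        by (simp add: R_def[abs_def] field_simps)
    qed
    then obtain r where r: "r \<in> {s<..<t}" "R t - R s = c r / R r * (t - s)"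
      using mvt_simple[OF True, of R "\<lambda>r. (*) (c r / R r)"]
      unfolding has_field_derivative_def by auto
    have "L2_norm (e r) \<le> R r"
      unfolding R_def using that by (intro real_le_rsqrt) simp
    then have "\<bar>c r\<bar> \<le> M * R r"
      using c(2)[of r] r(1) M mult_left_mono[of "L2_norm (e r)" "R r" M] by force
    then have "\<bar>c r / R r\<bar> \<le> M"
      using R[of r] by (simp add: abs_divide field_simps)
    then have "\<bar>c r / R r * (t - s)\<bar> \<le> M * (t - s)"
      using True M unfolding abs_mult by (intro mult_mono) auto
    then show ?thesis
      using r(2) by (simp add: R_def)
  qed
  have "((\<lambda>\<epsilon>. \<bar>sqrt ((L2_norm (e t))\<^sup>2 + \<epsilon>) - sqrt ((L2_norm (e s))\<^sup>2 + \<epsilon>)\<bar>) \<longlongrightarrow>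
      \<bar>sqrt ((L2_norm (e t))\<^sup>2 + 0) - sqrt ((L2_norm (e s))\<^sup>2 + 0)\<bar>) (at_right 0)"
    by (intro tendsto_intros)
  then have "((\<lambda>\<epsilon>. \<bar>sqrt ((L2_norm (e t))\<^sup>2 + \<epsilon>) - sqrt ((L2_norm (e s))\<^sup>2 + \<epsilon>)\<bar>) \<longlongrightarrow>
      \<bar>L2_norm (e t) - L2_norm (e s)\<bar>) (at_right 0)"
    by simp
  moreover have "\<forall>\<^sub>F \<epsilon> in at_right 0.
      \<bar>sqrt ((L2_norm (e t))\<^sup>2 + \<epsilon>) - sqrt ((L2_norm (e s))\<^sup>2 + \<epsilon>)\<bar> \<le> M * (t - s)"
    by (simp add: eventually_at_filter reg)
  ultimately show ?thesis
    by (rule tendsto_upperbound) simp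
qed

lemma solves_diff_perturbed_conservative:
  assumes v: "solves D F T v" and w: "solves D F' T w" and D: "D \<subseteq> L2_fun"
    and split: "\<And>t. t \<in> T \<Longrightarrow> \<exists>l p g. sq_integrable l \<and> sq_integrable g \<and>
        Im (L2_inner l (\<lambda>x. v t x - w t x)) = 0 \<and> L2_norm g \<le> M \<and>
        (AE x in torus. F t (v t) x - F' t (w t) x
          = l x + of_real (p x) * (v t x - w t x) + g x)"
  shows "perturbed_conservative M T (\<lambda>t x. v t x - w t x)"
  unfolding perturbed_conservative_def
proof (intro ballI conjI)
  fix t assume t: "t \<in> T"
  have sq: "sq_integrable (v s)" "sq_integrable (w s)" if "s \<in> T" for s
    using v w D that unfolding solves_def by (auto intro: L2_fun_sq_integrable)
  show "sq_integrable (\<lambda>x. v t x - w t x)"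
    by (intro sq_integrable_diff sq t)
  obtain v' where v': "v' \<in> L2_fun" "has_L2_derivative v v' t T" "L2_eq (\<lambda>x. \<i> * v' x) (F t (v t))"
    using v t unfolding solves_def by blast
  obtain w' where w': "w' \<in> L2_fun" "has_L2_derivative w w' t T" "L2_eq (\<lambda>x. \<i> * w' x) (F' t (w t))"
    using w t unfolding solves_def by blast
  obtain l p g where *: "sq_integrable l" "sq_integrable g"
    "Im (L2_inner l (\<lambda>x. v t x - w t x)) = 0" "L2_norm g \<le> M"
    "AE x in torus. F t (v t) x - F' t (w t) x = l x + of_real (p x) * (v t x - w t x) + g x"
    using split[OF t] by blast
  have "AE x in torus. \<i> * (v' x - w' x) = l x + of_real (p x) * (v t x - w t x) + g x"
    using *(5) v'(3) w'(3) unfolding L2_eq_def by eventually_elim (simp add: right_diff_distrib)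
  moreover have "has_L2_derivative (\<lambda>t x. v t x - w t x) (\<lambda>x. v' x - w' x) t T"
    using v'(2) w'(2) sq t L2_fun_sq_integrable[OF v'(1)] L2_fun_sq_integrable[OF w'(1)]
    by (intro has_L2_derivative_diff)
  moreover have "sq_integrable (\<lambda>x. v' x - w' x)"
    using v' w' by (intro sq_integrable_diff L2_fun_sq_integrable)
  ultimately show "\<exists>e' l p g. sq_integrable e' \<and> sq_integrable l \<and> sq_integrable g \<and>
      has_L2_derivative (\<lambda>t x. v t x - w t x) e' t T \<and> Im (L2_inner l (\<lambda>x. v t x - w t x)) = 0 \<and>
      L2_norm g \<le> M \<and> (AE x in torus. \<i> * e' x = l x + of_real (p x) * (v t x - w t x) + g x)"
    using *(1-4) by blast
qed

section \<open>Self-adjointness\<close>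

lemma self_adjoint_domain: "self_adjoint D L \<Longrightarrow> D \<subseteq> L2_fun"
  by (simp add: self_adjoint_def L2_operator_def)

lemma self_adjoint_range: "self_adjoint D L \<Longrightarrow> v \<in> D \<Longrightarrow> L v \<in> L2_fun"
  by (simp add: self_adjoint_def L2_operator_def)

lemma self_adjoint_scale:
  assumes "self_adjoint D L" "v \<in> D"
  shows "(\<lambda>x. c * v x) \<in> D"
proof -
  have "(\<lambda>x. c * v x + 0 * v x) \<in> D"
    using assms unfolding self_adjoint_def L2_operator_def by blast
  then show ?thesis
    by simp
qed

lemma self_adjoint_diff:
  assumes "self_adjoint D L" "v \<in> D" "w \<in> D"
  shows "(\<lambda>x. v x - w x) \<in> D" "AE x in torus. L (\<lambda>x. v x - w x) x = L v x - L w x"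
proof -
  have "(\<lambda>x. 1 * v x + (-1) * w x) \<in> D \<and>
      L2_eq (L (\<lambda>x. 1 * v x + (-1) * w x)) (\<lambda>x. 1 * L v x + (-1) * L w x)"
    using assms unfolding self_adjoint_def L2_operator_def by blast
  then show "(\<lambda>x. v x - w x) \<in> D" "AE x in torus. L (\<lambda>x. v x - w x) x = L v x - L w x"
    by (simp_all add: L2_eq_def)
qed

lemma self_adjoint_quadratic_form_real:
  assumes L: "self_adjoint D L" and v: "v \<in> D"
  shows "Im (L2_inner (L v) v) = 0"
proof -
  have "v \<in> L2_fun" "L v \<in> L2_fun"
    using L v self_adjoint_domain self_adjoint_range by blast+
  then have "(\<forall>z\<in>D. L2_inner (L z) v = L2_inner z (L v)) \<longleftrightarrow> v \<in> D \<and> L2_eq (L v) (L v)"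
    using L unfolding self_adjoint_def by blast
  then have "L2_inner (L v) v = L2_inner v (L v)"
    using v by (auto simp: L2_eq_def)
  also have "\<dots> = cnj (L2_inner (L v) v)"
    by (rule L2_inner_commute)
  finally show ?thesis
    by (simp add: complex_eq_iff)
qed

lemma linear_flow_unique:
  assumes L: "self_adjoint D L" and v: "solves D (\<lambda>_. L) {0..\<tau>} v" and w: "solves D (\<lambda>_. L) {0..\<tau>} w"
    and init: "L2_eq (v 0) (w 0)" and \<tau>: "0 \<le> \<tau>"
  shows "L2_eq (v \<tau>) (w \<tau>)"
proof -
  have D: "v t \<in> D" "w t \<in> D" if "t \<in> {0..\<tau>}" for t
    using v w that unfolding solves_def by auto
  have sq: "sq_integrable (v t)" "sq_integrable (w t)" if "t \<in> {0..\<tau>}" for t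
    using D[OF that] self_adjoint_domain[OF L] by (auto intro: L2_fun_sq_integrable)
  have "perturbed_conservative 0 {0..\<tau>} (\<lambda>t x. v t x - w t x)"
  proof (rule solves_diff_perturbed_conservative[OF v w self_adjoint_domain[OF L]])
    fix t assume t: "t \<in> {0..\<tau>}"
    note d = self_adjoint_diff[OF L D[OF t]]
    have "AE x in torus. L (v t) x - L (w t) x
        = L (\<lambda>x. v t x - w t x) x + of_real 0 * (v t x - w t x) + 0"
      using d(2) by eventually_elim simp
    then show "\<exists>l p g. sq_integrable l \<and> sq_integrable g \<and>
        Im (L2_inner l (\<lambda>x. v t x - w t x)) = 0 \<and> L2_norm g \<le> 0 \<and>
        (AE x in torus. L (v t) x - L (w t) x = l x + of_real (p x) * (v t x - w t x) + g x)"
      using self_adjoint_range[OF L d(1)] self_adjoint_quadratic_form_real[OF L d(1)]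
      by - (rule exI[of _ "L (\<lambda>x. v t x - w t x)"], rule exI[of _ "\<lambda>_. 0"],
          rule exI[of _ "\<lambda>_. 0"], simp add: L2_fun_sq_integrable)
  qed
  from perturbed_conservative_norm_growth[OF this order_refl \<tau> order_refl] show ?thesis
    using init \<tau> by (simp add: L2_eq_iff_norm_diff sq)
qed

section \<open>The frozen sub-step\<close>

text \<open>
  Pointwise, \<open>\<partial>\<^sub>t |v|\<^sup>2 = 2 Re (-\<i> f(|v|) |v|\<^sup>2) = 0\<close>.  The derivative is available in \<open>L\<^sub>2\<close> only, so the
  equation is restricted to a measurable set \<open>A\<close>, on which it is again conservative.  Hence \<open>|v|\<^sup>2\<close> has a
  constant integral over every \<open>A\<close>, which determines it almost everywhere.
\<close>

lemma nonlinear_flow_modulus: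
  assumes v: "solves L2_fun (\<lambda>_ y. potential f y y) {0..\<sigma>} v" and t: "t \<in> {0..\<sigma>}"
  shows "AE x in torus. cmod (v t x) = cmod (v 0 x)"
proof -
  have sq: "sq_integrable (v s)" if "s \<in> {0..\<sigma>}" for s
    using v that unfolding solves_def by (auto intro: L2_fun_sq_integrable)
  have zero: "(0::real) \<in> {0..\<sigma>}"
    using t by simp
  have "(LINT x:A|torus. (cmod (v t x))\<^sup>2) = (LINT x:A|torus. (cmod (v 0 x))\<^sup>2)"
    if A: "A \<in> sets torus" for A
  proof -
    define r where "r y x = of_real (indicator A x) * y x" for y :: "'a field" and x
    have r_sq: "sq_integrable (r y)" if "sq_integrable y" for y
      using sq_integrable_restrict[OF that A] by (simp add: r_def[abs_def])
    have r_le: "L2_norm (r y) \<le> L2_norm y" if "sq_integrable y" for y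
      unfolding L2_norm_def using that r_sq[OF that]
      by (intro real_sqrt_le_mono integral_mono) (auto simp: sq_integrable_def r_def indicator_def)
    have "perturbed_conservative 0 {0..\<sigma>} (\<lambda>s. r (v s))"
      unfolding perturbed_conservative_def
    proof (intro ballI conjI)
      fix s assume s: "s \<in> {0..\<sigma>}"
      show "sq_integrable (r (v s))"
        by (intro r_sq sq s)
      obtain v' where v': "v' \<in> L2_fun" "has_L2_derivative v v' s {0..\<sigma>}"
        "L2_eq (\<lambda>x. \<i> * v' x) (potential f (v s) (v s))"
        using v s unfolding solves_def by blast
      have sq': "sq_integrable v'"
        using v'(1) by (rule L2_fun_sq_integrable)
      have "L2_norm (\<lambda>x. (r (v s') x - r (v s) x) / of_real (s' - s) - r v' x)
          \<le> L2_norm (\<lambda>x. (v s' x - v s x) / of_real (s' - s) - v' x)" if "s' \<in> {0..\<sigma>}" for s'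
      proof -
        have "sq_integrable (\<lambda>x. inverse (of_real (s' - s)) * (v s' x - v s x) - v' x)"
          by (intro sq_integrable_diff sq_integrable_mult_const sq sq' s that)
        then have "sq_integrable (\<lambda>x. (v s' x - v s x) / of_real (s' - s) - v' x)"
          by (simp add: divide_inverse mult.commute)
        moreover have "(\<lambda>x. (r (v s') x - r (v s) x) / of_real (s' - s) - r v' x)
            = r (\<lambda>x. (v s' x - v s x) / of_real (s' - s) - v' x)"
          by (simp only: r_def fun_eq_iff right_diff_distrib times_divide_eq_right simp_thms)
        ultimately show ?thesis
          using r_le by simp
      qed
      then have "\<forall>\<^sub>F s' in at s within {0..\<sigma>}.
          norm (L2_norm (\<lambda>x. (r (v s') x - r (v s) x) / of_real (s' - s) - r v' x))
          \<le> L2_norm (\<lambda>x. (v s' x - v s x) / of_real (s' - s) - v' x)"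
        by (simp add: eventually_at_filter del: of_real_diff)
      then have "has_L2_derivative (\<lambda>s. r (v s)) (r v') s {0..\<sigma>}"
        using v'(2) unfolding has_L2_derivative_def by (rule Lim_null_comparison)
      moreover have "AE x in torus. \<i> * r v' x = 0 + of_real (f (cmod (v s x))) * r (v s) x + 0"
        using v'(3) unfolding L2_eq_def
        by eventually_elim (simp add: potential_def r_def mult.left_commute)
      ultimately show "\<exists>e' l p g. sq_integrable e' \<and> sq_integrable l \<and> sq_integrable g \<and>
          has_L2_derivative (\<lambda>s. r (v s)) e' s {0..\<sigma>} \<and> Im (L2_inner l (r (v s))) = 0 \<and>
          L2_norm g \<le> 0 \<and> (AE x in torus. \<i> * e' x = l x + of_real (p x) * r (v s) x + g x)"
        using r_sq[OF sq']
        by - (rule exI[of _ "r v'"], rule exI[of _ "\<lambda>_. 0"], rule exI[of _ "\<lambda>x. f (cmod (v s x))"],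
            rule exI[of _ "\<lambda>_. 0"], simp add: L2_inner_def)
    qed
    from perturbed_conservative_norm_growth[OF this order_refl, of t]
    have "(L2_norm (r (v t)))\<^sup>2 = (L2_norm (r (v 0)))\<^sup>2"
      using t by simp
    moreover have "(L2_norm (r y))\<^sup>2 = (LINT x:A|torus. (cmod (y x))\<^sup>2)" for y
      unfolding L2_norm_sq set_lebesgue_integral_def r_def
      by (intro Bochner_Integration.integral_cong) (auto simp: indicator_def)
    ultimately show ?thesis
      by simp
  qed
  then have "AE x in torus. (cmod (v t x))\<^sup>2 = (cmod (v 0 x))\<^sup>2"
    using sq[OF t] sq[OF zero] by (intro density_unique_real) (auto simp: sq_integrable_def)
  then show ?thesis
    by simp
qed

text \<open>
  As \<open>|v|\<close> stays equal to \<open>|w|\<close>, the nonlinear solution \<open>v\<close> solves the frozen linear equation as well,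
  whose solution is unique.
\<close>

lemma frozen_flow_eq_nonlinear_flow:
  assumes v: "solves L2_fun (\<lambda>_ y. potential f y y) {0..\<sigma>} v"
    and z: "solves L2_fun (\<lambda>_ y. potential f w y) {0..\<sigma>} z"
    and init: "L2_eq (v 0) w" "L2_eq (z 0) w" and \<sigma>: "0 \<le> \<sigma>"
  shows "L2_eq (v \<sigma>) (z \<sigma>)"
proof -
  have sq: "sq_integrable (v t)" "sq_integrable (z t)" if "t \<in> {0..\<sigma>}" for t
    using v z that unfolding solves_def by (auto intro: L2_fun_sq_integrable)
  have "perturbed_conservative 0 {0..\<sigma>} (\<lambda>t x. v t x - z t x)"
  proof (rule solves_diff_perturbed_conservative[OF v z order_refl])
    fix t assume t: "t \<in> {0..\<sigma>}"
    have "AE x in torus. potential f (v t) (v t) x - potential f w (z t) x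
        = 0 + of_real (f (cmod (w x))) * (v t x - z t x) + 0"
      using nonlinear_flow_modulus[OF v t] init(1) unfolding L2_eq_def
      by eventually_elim (simp add: potential_def right_diff_distrib)
    then show "\<exists>l p g. sq_integrable l \<and> sq_integrable g \<and>
        Im (L2_inner l (\<lambda>x. v t x - z t x)) = 0 \<and> L2_norm g \<le> 0 \<and>
        (AE x in torus. potential f (v t) (v t) x - potential f w (z t) x
          = l x + of_real (p x) * (v t x - z t x) + g x)"
      by - (rule exI[of _ "\<lambda>_. 0"], rule exI[of _ "\<lambda>x. f (cmod (w x))"],
          rule exI[of _ "\<lambda>_. 0"], simp add: L2_inner_def)
  qed
  from perturbed_conservative_norm_growth[OF this order_refl \<sigma> order_refl] show ?thesis
    using L2_eq_trans[OF init(1) L2_eq_sym[OF init(2)]] \<sigma> by (simp add: L2_eq_iff_norm_diff sq)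
qed

lemma strang_frozen_eq_nonlinear:
  assumes L: "self_adjoint D L" and \<sigma>: "0 \<le> \<sigma>"
    and y: "strang_nonlinear D L f \<sigma> a y" and z: "strang_frozen D L f \<sigma> a z"
  shows "L2_eq y z" "y \<in> D" "z \<in> D"
proof -
  have \<sigma>2: "0 \<le> \<sigma> / 2"
    using \<sigma> by simp
  obtain v1 v2 v3 where v:
    "solves D (\<lambda>_. L) {0..\<sigma>/2} v1" "L2_eq (v1 0) a"
    "solves L2_fun (\<lambda>_ y. potential f y y) {0..\<sigma>} v2" "L2_eq (v2 0) (v1 (\<sigma>/2))"
    "solves D (\<lambda>_. L) {0..\<sigma>/2} v3" "L2_eq (v3 0) (v2 \<sigma>)" "y = v3 (\<sigma>/2)"
    using y unfolding strang_nonlinear_def strang_step_def by blast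
  obtain z1 z2 z3 where z:
    "solves D (\<lambda>_. L) {0..\<sigma>/2} z1" "L2_eq (z1 0) a"
    "solves L2_fun (\<lambda>_ y. potential f (z1 (\<sigma>/2)) y) {0..\<sigma>} z2" "L2_eq (z2 0) (z1 (\<sigma>/2))"
    "solves D (\<lambda>_. L) {0..\<sigma>/2} z3" "L2_eq (z3 0) (z2 \<sigma>)" "z = z3 (\<sigma>/2)"
    using z unfolding strang_frozen_def strang_step_def by blast
  have "L2_eq (v1 (\<sigma>/2)) (z1 (\<sigma>/2))"
    using linear_flow_unique[OF L v(1) z(1) L2_eq_trans[OF v(2) L2_eq_sym[OF z(2)]] \<sigma>2] .
  then have "L2_eq (v2 \<sigma>) (z2 \<sigma>)"
    using frozen_flow_eq_nonlinear_flow[OF v(3) z(3) _ z(4) \<sigma>] L2_eq_trans[OF v(4)] by blast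
  then have "L2_eq (v3 0) (z3 0)"
    using v(6) z(6) L2_eq_trans L2_eq_sym by blast
  then show "L2_eq y z"
    using linear_flow_unique[OF L v(5) z(5) _ \<sigma>2] v(7) z(7) by simp
  show "y \<in> D" "z \<in> D"
    using v(5,7) z(5,7) \<sigma> unfolding solves_def by auto
qed

section \<open>One step of the iteration\<close>

text \<open>
  The Frechet bound speaks of arguments \<open>z\<close> in the unit ball.  Dividing a general \<open>z\<close> by some
  \<open>r > \<parallel>z\<parallel>\<close> and letting \<open>r\<close> decrease to \<open>\<parallel>z\<parallel>\<close> covers \<open>\<parallel>z\<parallel> = 0\<close> without a case distinction.
\<close>

lemma frechet_bound_apply:
  assumes L: "self_adjoint D L" and G': "frechet_bound D L f \<Delta> v K"
    and \<delta>: "\<delta> \<in> \<Delta>" and z: "z \<in> D"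
  defines "g \<equiv> (\<lambda>x. G_op L f (\<lambda>y. v y + \<delta> y) z x - G_op L f v z x)"
  shows "sq_integrable g" "L2_norm g \<le> K * L2_norm \<delta> * L2_norm z"
proof -
  define A where "A z = (\<lambda>x. G_op L f (\<lambda>y. v y + \<delta> y) z x - G_op L f v z x)" for z
  define B where "B = K * L2_norm \<delta>"
  have B: "0 \<le> B"
    using G' by (simp add: B_def frechet_bound_def)
  have "L2_op_norm D A \<le> ennreal B"
    using G' \<delta> unfolding frechet_bound_def A_def B_def by blast
  then have unit: "A y \<in> L2_fun \<and> L2_norm (A y) \<le> B" if "y \<in> D" "L2_norm y \<le> 1" for y
    using that B unfolding L2_op_norm_def SUP_le_iff by (force split: if_splits simp: top_unique)
  \<comment> \<open>The summand \<open>L\<close> cancels, so the difference is homogeneous pointwise.\<close>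
  have hom: "A (\<lambda>x. c * y x) = (\<lambda>x. c * A y x)" for c y
    by (simp add: A_def G_op_def potential_def fun_eq_iff algebra_simps)
  have scaled: "sq_integrable (A z) \<and> L2_norm (A z) \<le> B * r" if "L2_norm z < r" for r
  proof -
    have r: "0 < r"
      using that L2_norm_nonneg[of z] by linarith
    have "(\<lambda>x. of_real (inverse r) * z x) \<in> D"
      by (rule self_adjoint_scale[OF L z])
    moreover have "L2_norm (\<lambda>x. of_real (inverse r) * z x) \<le> 1"
      using r that unfolding L2_norm_mult_const norm_of_real by (simp add: field_simps)
    ultimately have *: "A (\<lambda>x. of_real (inverse r) * z x) \<in> L2_fun"
        "L2_norm (A (\<lambda>x. of_real (inverse r) * z x)) \<le> B"
      using unit by blast+
    have "sq_integrable (\<lambda>x. of_real r * A (\<lambda>x. of_real (inverse r) * z x) x)"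
      using *(1) by (intro sq_integrable_mult_const L2_fun_sq_integrable)
    then have "sq_integrable (A z)"
      using r unfolding hom by (simp flip: mult.assoc)
    moreover have "inverse r * L2_norm (A z) \<le> B"
      using *(2) r unfolding hom L2_norm_mult_const norm_of_real by simp
    ultimately show ?thesis
      using r by (simp add: hom field_simps)
  qed
  have g: "g = A z"
    by (simp add: g_def A_def)
  show "sq_integrable g"
    unfolding g using scaled[of "L2_norm z + 1"] by simp
  have "((\<lambda>r. B * r) \<longlongrightarrow> B * L2_norm z) (at_right (L2_norm z))"
    by (intro tendsto_intros)
  moreover have "\<forall>\<^sub>F r in at_right (L2_norm z). L2_norm g \<le> B * r"
    unfolding g by (simp add: eventually_at_filter scaled)
  ultimately show "L2_norm g \<le> K * L2_norm \<delta> * L2_norm z"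
    unfolding B_def[symmetric] by (rule tendsto_lowerbound) simp
qed

lemma nonlinear_solution_norm_conserved:
  assumes L: "self_adjoint D L" and u: "solves D (\<lambda>_. H_op L f) {a..b} u" and t: "t \<in> {a..b}"
  shows "L2_norm (u t) = L2_norm (u a)"
proof -
  have "perturbed_conservative 0 {a..b} u"
    unfolding perturbed_conservative_def
  proof (intro ballI conjI)
    fix s assume s: "s \<in> {a..b}"
    have us: "u s \<in> D"
      using u s unfolding solves_def by auto
    then show "sq_integrable (u s)"
      using self_adjoint_domain[OF L] L2_fun_sq_integrable by blast
    obtain u' where u': "u' \<in> L2_fun" "has_L2_derivative u u' s {a..b}"
      "L2_eq (\<lambda>x. \<i> * u' x) (H_op L f (u s))"
      using u s unfolding solves_def by blast
    show "\<exists>e' l p g. sq_integrable e' \<and> sq_integrable l \<and> sq_integrable g \<and>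
        has_L2_derivative u e' s {a..b} \<and> Im (L2_inner l (u s)) = 0 \<and>
        L2_norm g \<le> 0 \<and> (AE x in torus. \<i> * e' x = l x + of_real (p x) * u s x + g x)"
      using u' self_adjoint_range[OF L us] self_adjoint_quadratic_form_real[OF L us]
      by - (rule exI[of _ u'], rule exI[of _ "L (u s)"], rule exI[of _ "\<lambda>x. f (cmod (u s x))"],
          rule exI[of _ "\<lambda>_. 0"],
          simp add: L2_fun_sq_integrable L2_eq_def H_op_def G_op_def potential_def)
  qed
  from perturbed_conservative_norm_growth[OF this order_refl, of t] show ?thesis
    using t by simp
qed

text \<open>
  Here \<open>v\<close> is the current iterate and \<open>w\<close> the next one.  Splitting
  \<open>G(v) w - G(u) u = G(v) (w - u) + (G(v) - G(u)) u\<close> isolates the conservative part.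
\<close>

lemma iteration_error_step:
  assumes L: "self_adjoint D L" and u: "solves D (\<lambda>_. H_op L f) {a..b} u"
    and G': "\<And>t. t \<in> {a..b} \<Longrightarrow> frechet_bound D L f \<Delta> (u t) K"
    and w: "solves D (\<lambda>t. G_op L f (v t)) {a..b} w" and init: "L2_eq (w a) (u a)"
    and range: "\<And>t. t \<in> {a..b} \<Longrightarrow> (\<lambda>x. v t x - u t x) \<in> \<Delta>"
    and B: "\<And>t. t \<in> {a..b} \<Longrightarrow> L2_norm (\<lambda>x. v t x - u t x) \<le> B"
    and t: "t \<in> {a..b}"
  shows "L2_norm (\<lambda>x. w t x - u t x) \<le> K * L2_norm (u a) * B * (t - a)"
proof -
  have D: "w s \<in> D" "u s \<in> D" if "s \<in> {a..b}" for s
    using w u that unfolding solves_def by auto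
  have a: "a \<in> {a..b}"
    using t by simp
  have K: "0 < K"
    using G'[OF a] by (simp add: frechet_bound_def)
  have "perturbed_conservative (K * L2_norm (u a) * B) {a..b} (\<lambda>s x. w s x - u s x)"
  proof (rule solves_diff_perturbed_conservative[OF w u self_adjoint_domain[OF L]])
    fix s assume s: "s \<in> {a..b}"
    define \<delta> where "\<delta> x = v s x - u s x" for x
    define g where "g x = G_op L f (\<lambda>y. u s y + \<delta> y) (u s) x - G_op L f (u s) (u s) x" for x
    have \<delta>: "\<delta> \<in> \<Delta>" "L2_norm \<delta> \<le> B"
      using range[OF s] B[OF s] by (simp_all add: \<delta>_def[abs_def])
    note g_bound = frechet_bound_apply[OF L G'[OF s] \<delta>(1) D(2)[OF s], folded g_def[abs_def]]
    have "(K * L2_norm (u a)) * L2_norm \<delta> \<le> (K * L2_norm (u a)) * B"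
      using \<delta>(2) K by (intro mult_left_mono) auto
    then have "K * L2_norm \<delta> * L2_norm (u s) \<le> K * L2_norm (u a) * B"
      using nonlinear_solution_norm_conserved[OF L u s] by (simp add: mult_ac)
    then have g_le: "L2_norm g \<le> K * L2_norm (u a) * B"
      using g_bound(2) by linarith
    note d = self_adjoint_diff[OF L D[OF s]]
    have "AE x in torus. G_op L f (v s) (w s) x - H_op L f (u s) x
        = L (\<lambda>x. w s x - u s x) x + of_real (f (cmod (v s x))) * (w s x - u s x) + g x"
      using d(2) by eventually_elim
        (simp add: g_def \<delta>_def G_op_def H_op_def potential_def algebra_simps)
    then show "\<exists>l p g. sq_integrable l \<and> sq_integrable g \<and>
        Im (L2_inner l (\<lambda>x. w s x - u s x)) = 0 \<and> L2_norm g \<le> K * L2_norm (u a) * B \<and>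
        (AE x in torus. G_op L f (v s) (w s) x - H_op L f (u s) x
          = l x + of_real (p x) * (w s x - u s x) + g x)"
      using g_bound(1) g_le L2_fun_sq_integrable[OF self_adjoint_range[OF L d(1)]]
        self_adjoint_quadratic_form_real[OF L d(1)]
      by - (rule exI[of _ "L (\<lambda>x. w s x - u s x)"], rule exI[of _ "\<lambda>x. f (cmod (v s x))"],
          rule exI[of _ g], simp)
  qed
  from perturbed_conservative_norm_growth[OF this order_refl, of t]
  have "\<bar>L2_norm (\<lambda>x. w t x - u t x) - L2_norm (\<lambda>x. w a x - u a x)\<bar>
      \<le> K * L2_norm (u a) * B * (t - a)"
    using t by simp
  moreover have "L2_norm (\<lambda>x. w a x - u a x) = 0"
    using init D[OF a] self_adjoint_domain[OF L] L2_fun_sq_integrable L2_eq_iff_norm_diff by blast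
  ultimately show ?thesis
    by simp
qed

section \<open>Order and convergence of the iteration\<close>

theorem theorem3:
  fixes D \<Delta> :: "(real ^ 'd::finite \<Rightarrow> complex) set"
    and L :: "(real ^ 'd \<Rightarrow> complex) \<Rightarrow> (real ^ 'd \<Rightarrow> complex)"
    and f :: "real \<Rightarrow> real"
    and steps :: "real set"
    and tn c1 G' :: real
    and u S :: "real \<Rightarrow> real ^ 'd \<Rightarrow> complex"
    and U :: "nat \<Rightarrow> real \<Rightarrow> real ^ 'd \<Rightarrow> complex"
    and \<rho> :: "nat \<Rightarrow> real \<Rightarrow> real"
  assumes L: "self_adjoint D L" "differential_operator D L"
    and steps: "\<And>h. h \<in> steps \<Longrightarrow> 0 < h"
    and u: "\<And>h. h \<in> steps \<Longrightarrow> solves D (\<lambda>_. H_op L f) {tn..tn+h} u"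
    and G': "\<And>h t. h \<in> steps \<Longrightarrow> t \<in> {tn..tn+h} \<Longrightarrow> frechet_bound D L f \<Delta> (u t) G'"
    and strang: "\<And>h \<sigma>. h \<in> steps \<Longrightarrow> \<sigma> \<in> {0..h} \<Longrightarrow> strang_nonlinear D L f \<sigma> (u tn) (S \<sigma>)"
    and strang_error: "0 < c1" "\<And>h \<sigma>. h \<in> steps \<Longrightarrow> \<sigma> \<in> {0..h} \<Longrightarrow>
          L2_norm (\<lambda>x. S \<sigma> x - u (tn + \<sigma>) x) \<le> c1 * h ^ 3"
    and U0: "\<And>t. U 0 t = u tn"
    and U1: "\<And>h \<sigma>. h \<in> steps \<Longrightarrow> \<sigma> \<in> {0..h} \<Longrightarrow> strang_frozen D L f \<sigma> (u tn) (U 1 (tn + \<sigma>))"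
    and U_Suc: "\<And>k h. 1 \<le> k \<Longrightarrow> h \<in> steps \<Longrightarrow>
          solves D (\<lambda>t. G_op L f (U k t)) {tn..tn+h} (U (k + 1)) \<and> L2_eq (U (k + 1) tn) (u tn)"
    and errors_in_range: "\<And>k h t. 1 \<le> k \<Longrightarrow> h \<in> steps \<Longrightarrow> t \<in> {tn..tn+h} \<Longrightarrow>
          (\<lambda>x. U k t x - u t x) \<in> \<Delta>"
    and rho: "\<And>k t. \<rho> k t = L2_norm (\<lambda>x. U k t x - u t x)"
  shows "(\<forall>k\<ge>1. has_order steps tn (\<rho> k) (k + 1)) \<and>
    (\<forall>k\<ge>1. \<forall>h\<in>steps. \<forall>t\<in>{tn..tn+h}.
       \<rho> k t \<le> (G' * L2_norm (u tn)) ^ (k - 1) * c1 * h ^ (k + 2)) \<and>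
    (\<forall>h\<in>steps. L2_norm (u tn) = 0 \<or> h < inverse (G' * L2_norm (u tn)) \<longrightarrow>
       (\<forall>t\<in>{tn..tn+h}. (\<lambda>k. \<rho> k t) \<longlonglongrightarrow> 0))"
proof -
  define q where "q = G' * L2_norm (u tn)"
  have bound: "\<forall>t\<in>{tn..tn+h}. \<rho> k t \<le> q ^ (k - 1) * c1 * h ^ (k + 2)"
    if h: "h \<in> steps" and "1 \<le> k" for k h
    using \<open>1 \<le> k\<close>
  proof (induction k rule: dec_induct)
    case base
    show ?case
    proof
      fix t assume t: "t \<in> {tn..tn+h}"
      define \<sigma> where "\<sigma> = t - tn"
      have \<sigma>: "\<sigma> \<in> {0..h}" "t = tn + \<sigma>"
        using t by (auto simp: \<sigma>_def)
      note eq = strang_frozen_eq_nonlinear[OF L(1) _ strang[OF h \<sigma>(1)] U1[OF h \<sigma>(1)]]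
      have ut: "u t \<in> D"
        using u[OF h] t unfolding solves_def by auto
      have "S \<sigma> \<in> D" "U 1 t \<in> D" "L2_eq (S \<sigma>) (U 1 t)"
        using eq \<sigma> by auto
      then have "L2_norm (\<lambda>x. U 1 t x - u t x) = L2_norm (\<lambda>x. S \<sigma> x - u t x)"
        using ut self_adjoint_domain[OF L(1)]
        by (intro L2_norm_cong_AE sq_integrable_diff L2_fun_sq_integrable)
           (auto simp: L2_eq_def elim: eventually_mono)
      then show "\<rho> 1 t \<le> q ^ (1 - 1) * c1 * h ^ (1 + 2)"
        using strang_error(2)[OF h \<sigma>(1)] by (simp add: rho \<sigma>(2) power3_eq_cube)
    qed
  next
    case (step k)
    have h0: "0 < h"
      using steps[OF h] .
    define B where "B = q ^ (k - 1) * c1 * h ^ (k + 2)"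
    have "0 < G'"
      using G'[OF h, of tn] h0 by (simp add: frechet_bound_def)
    then have q: "0 \<le> q"
      by (simp add: q_def)
    then have B: "0 \<le> B"
      using strang_error(1) h0 by (simp add: B_def)
    show ?case
    proof
      fix t assume t: "t \<in> {tn..tn+h}"
      have "\<rho> (Suc k) t \<le> q * B * (t - tn)"
        unfolding rho q_def
        using iteration_error_step[OF L(1) u[OF h] G'[OF h], of "U k" "U (k + 1)" B t]
          U_Suc[OF step(1) h] errors_in_range[OF step(1) h] step(3) t by (simp add: rho B_def)
      also have "\<dots> \<le> q * B * h"
        using t q B by (intro mult_left_mono) auto
      also have "\<dots> = q ^ (Suc k - 1) * c1 * h ^ (Suc k + 2)"
        using step(1) by (cases k) (simp_all add: B_def)
      finally show "\<rho> (Suc k) t \<le> q ^ (Suc k - 1) * c1 * h ^ (Suc k + 2)" .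
    qed
  qed
  have order: "has_order steps tn (\<rho> k) (k + 1)" if "1 \<le> k" for k
  proof -
    \<comment> \<open>For \<open>u = 0\<close> the constant of the estimate vanishes, while an order requires a positive
        one; hence the maximum.\<close>
    have "\<rho> k t \<le> max 1 (q ^ (k - 1) * c1) * h ^ (k + 1 + 1)" if "h \<in> steps" "t \<in> {tn..tn+h}" for h t
    proof -
      have "\<rho> k t \<le> q ^ (k - 1) * c1 * h ^ (k + 2)"
        using bound that \<open>1 \<le> k\<close> by blast
      also have "\<dots> \<le> max 1 (q ^ (k - 1) * c1) * h ^ (k + 2)"
        using steps[OF that(1)] by (intro mult_right_mono) auto
      finally show ?thesis
        by simp
    qed
    then show ?thesis
      unfolding has_order_def by (intro exI[of _ "max 1 (q ^ (k - 1) * c1)"]) auto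
  qed
  have conv: "(\<lambda>k. \<rho> k t) \<longlonglongrightarrow> 0"
    if h: "h \<in> steps" and small: "L2_norm (u tn) = 0 \<or> h < inverse q" and t: "t \<in> {tn..tn+h}" for h t
  proof -
    have h0: "0 < h"
      using steps[OF h] .
    have "0 < G'"
      using G'[OF h, of tn] h0 by (simp add: frechet_bound_def)
    then have "0 \<le> q"
      by (simp add: q_def)
    then have "q * h < 1"
    proof (cases "q = 0")
      case False
      then have "0 < q"
        using \<open>0 \<le> q\<close> by simp
      moreover have "h < inverse q"
        using small False by (auto simp: q_def)
      ultimately show ?thesis
        by (simp add: field_simps)
    qed simp
    with \<open>0 \<le> q\<close> h0 have "(\<lambda>k. (q * h) ^ k) \<longlonglongrightarrow> 0"
      by (intro LIMSEQ_realpow_zero) auto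
    then have lim: "(\<lambda>k. (q * h) ^ k * (c1 * h ^ 3)) \<longlonglongrightarrow> 0"
      by (rule tendsto_mult_left_zero)
    have "norm (\<rho> (Suc k) t) \<le> (q * h) ^ k * (c1 * h ^ 3)" for k
    proof -
      have "\<rho> (Suc k) t \<le> q ^ k * c1 * h ^ (k + 3)"
        using bound[OF h, of "Suc k"] t by (simp add: eval_nat_numeral)
      then show ?thesis
        by (simp add: rho power_mult_distrib power_add mult_ac)
    qed
    then have "(\<lambda>k. \<rho> (Suc k) t) \<longlonglongrightarrow> 0"
      by (intro Lim_null_comparison[OF _ lim]) simp
    then show ?thesis
      by (rule LIMSEQ_imp_Suc)
  qed
  show ?thesis
    using order bound conv unfolding q_def by blast
qed

end
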